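(* Let $\beta_1,\beta_2\in[0,1)$, $0<g<\infty$ and $k>0$ be real numbers. For each positive integer $t'$, run Adam with $\epsilon=0$ on a single parameter coordinate $i$, starting at timestep $-t'$, with the gradient sequence $$g_t^i=\begin{cases} g, & -t'\le t<0,\\ kg, & t\ge 0,\end{cases}$$ and let $\hat m_{-t',t}^i$ and $\hat v_{-t',t}^i$ be the resulting bias-corrected first and second momentum terms at timestep $t$, with update $u_t^i=\hat m_{-t',t}^i/\sqrt{\hat v_{-t',t}^i}$. Then for every integer $t\ge 0$, $$\lim_{t'\to\infty}u_t^i=\lim_{t'\to\infty}\frac{\hat m_{-t',t}^i}{\sqrt{\hat v_{-t',t}^i}}=\frac{\beta_1^{t+1}+k\,(1-\beta_1^{t+1})}{\sqrt{\beta_2^{t+1}+k^2(1-\beta_2^{t+1})}}.$$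
   Context: Adam started at timestep $-t'$ with coefficients $\beta_1,\beta_2$: for a scalar gradient sequence $(g_s^i)_{s\ge -t'}$, the uncorrected moments are initialised to zero, $m_{-t'-1}^i=v_{-t'-1}^i=0$, and for $s\ge -t'$ $$m_s^i=\beta_1 m_{s-1}^i+(1-\beta_1)g_s^i,\qquad v_s^i=\beta_2 v_{s-1}^i+(1-\beta_2)(g_s^i)^2.$$ The bias-corrected terms divide by $1-\beta^{n}$, where $n$ is the number of gradients processed so far; at timestep $t$ this is $n=t'+t+1$, so $$\hat m_{-t',t}^i=\frac{m_t^i}{1-\beta_1^{t'+t+1}},\qquad \hat v_{-t',t}^i=\frac{v_t^i}{1-\beta_2^{t'+t+1}}.$$ The general Adam update is $u_t^i=\hat m^i_{-t',t}/(\sqrt{\hat v^i_{-t',t}}+\epsilon)$, taken here with $\epsilon=0$. The convention $0^0=1$ is never needed, since all exponents of $\beta_1,\beta_2$ in the claim are at least $1$. *)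

theory Defs
  imports Complex_Main
begin

text \<open>
  Adam on one coordinate. Timesteps are integers, \<open>s0\<close> is the first timestep at which a gradient is
  processed, and \<open>G s\<close> is the gradient at timestep \<open>s\<close>. The uncorrected moments are \<open>0\<close> before the
  start, in particular at \<open>s0 - 1\<close>, so the values of \<open>G\<close> before \<open>s0\<close> are never used.
\<close>

function adam_m :: "real \<Rightarrow> (int \<Rightarrow> real) \<Rightarrow> int \<Rightarrow> int \<Rightarrow> real" where
  "adam_m \<beta>1 G s0 s =
     (if s < s0 then 0 else \<beta>1 * adam_m \<beta>1 G s0 (s - 1) + (1 - \<beta>1) * G s)"
  by pat_completeness auto
termination
  by (relation "measure (\<lambda>(\<beta>1, G, s0, s). nat (s - s0 + 1))") auto

function adam_v :: "real \<Rightarrow> (int \<Rightarrow> real) \<Rightarrow> int \<Rightarrow> int \<Rightarrow> real" where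
  "adam_v \<beta>2 G s0 s =
     (if s < s0 then 0 else \<beta>2 * adam_v \<beta>2 G s0 (s - 1) + (1 - \<beta>2) * (G s)\<^sup>2)"
  by pat_completeness auto
termination
  by (relation "measure (\<lambda>(\<beta>2, G, s0, s). nat (s - s0 + 1))") auto

text \<open>The unconditional recursion equations would make the simplifier loop.\<close>

declare adam_m.simps [simp del] adam_v.simps [simp del]

definition adam_m_hat :: "real \<Rightarrow> (int \<Rightarrow> real) \<Rightarrow> int \<Rightarrow> int \<Rightarrow> real" where
  "adam_m_hat \<beta>1 G s0 t = adam_m \<beta>1 G s0 t / (1 - \<beta>1 ^ nat (t - s0 + 1))"

definition adam_v_hat :: "real \<Rightarrow> (int \<Rightarrow> real) \<Rightarrow> int \<Rightarrow> int \<Rightarrow> real" where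
  "adam_v_hat \<beta>2 G s0 t = adam_v \<beta>2 G s0 t / (1 - \<beta>2 ^ nat (t - s0 + 1))"

definition adam_update :: "real \<Rightarrow> real \<Rightarrow> real \<Rightarrow> (int \<Rightarrow> real) \<Rightarrow> int \<Rightarrow> int \<Rightarrow> real" where
  "adam_update \<beta>1 \<beta>2 \<epsilon> G s0 t =
     adam_m_hat \<beta>1 G s0 t / (sqrt (adam_v_hat \<beta>2 G s0 t) + \<epsilon>)"

definition step_gradient :: "real \<Rightarrow> real \<Rightarrow> int \<Rightarrow> real" where
  "step_gradient g k s = (if s < 0 then g else k * g)"

end

theory Submission
  imports Defs
begin

text \<open>
  Along a stretch of \<open>j\<close> steps with constant gradient \<open>c\<close>, the first moment is carried from \<open>m\<close> to
  \<open>\<beta> ^ j * m + (1 - \<beta> ^ j) * c\<close>. Using this on the stretch before timestep \<open>0\<close> and on the one from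
  timestep \<open>0\<close> on gives the first moment in closed form. The second moment is the first moment of the
  squared gradients, which again form a step sequence.
\<close>

lemma adam_m_constant_stretch:
  assumes "s0 \<le> s + 1" and "\<And>r. s < r \<Longrightarrow> r \<le> s + int j \<Longrightarrow> G r = c"
  shows "adam_m \<beta> G s0 (s + int j) = \<beta> ^ j * adam_m \<beta> G s0 s + (1 - \<beta> ^ j) * c"
  using assms(2)
proof (induction j)
  case 0
  then show ?case by simp
next
  case (Suc j)
  have "adam_m \<beta> G s0 (s + int (Suc j)) =
      \<beta> * adam_m \<beta> G s0 (s + int j) + (1 - \<beta>) * G (s + int (Suc j))"
    using assms(1) by (subst adam_m.simps) simp
  also have "G (s + int (Suc j)) = c"
    by (rule Suc.prems) auto
  also have "adam_m \<beta> G s0 (s + int j) = \<beta> ^ j * adam_m \<beta> G s0 s + (1 - \<beta> ^ j) * c"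
    using Suc by simp
  finally show ?case
    by (simp add: algebra_simps)
qed

lemma adam_m_step_gradient:
  assumes "0 \<le> t"
  shows "adam_m \<beta> (step_gradient g k) (- int n) t =
    \<beta> ^ nat (t + 1) * ((1 - \<beta> ^ n) * g) + (1 - \<beta> ^ nat (t + 1)) * (k * g)"
proof -
  \<comment> \<open>The first stretch is anchored at \<open>- int n - 1\<close>, one timestep before
    the start, where the moment has its initial value \<open>0\<close>; \<open>n\<close> steps lead
    from there to \<open>- 1\<close>.\<close>
  have "adam_m \<beta> (step_gradient g k) (- int n) (- int n - 1) = 0"
    by (subst adam_m.simps) simp
  then have "adam_m \<beta> (step_gradient g k) (- int n) (- 1) = (1 - \<beta> ^ n) * g"
    using adam_m_constant_stretch[of "- int n" "- int n - 1" n "step_gradient g k" g \<beta>]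
    by (simp add: step_gradient_def)
  then show ?thesis
    using adam_m_constant_stretch[of "- int n" "- 1" "nat (t + 1)" "step_gradient g k" "k * g" \<beta>] assms
    by (simp add: step_gradient_def)
qed

text \<open>Both the zero initialisation and the bias correction enter only through powers of
  \<open>\<beta>\<close> that vanish as the start recedes; what remains is a weighted mean of
  \<open>g\<close> and \<open>k * g\<close>.\<close>

lemma adam_m_hat_step_gradient_tendsto:
  assumes "0 \<le> \<beta>" and "\<beta> < 1" and "0 \<le> t"
  shows "(\<lambda>n. adam_m_hat \<beta> (step_gradient g k) (- int n) t)
    \<longlonglongrightarrow> g * (\<beta> ^ nat (t + 1) + k * (1 - \<beta> ^ nat (t + 1)))"
proof -
  have pow: "(\<lambda>n. \<beta> ^ n) \<longlonglongrightarrow> 0"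
    using assms by (intro LIMSEQ_realpow_zero) auto
  have "(\<lambda>n. adam_m_hat \<beta> (step_gradient g k) (- int n) t) =
      (\<lambda>n. (\<beta> ^ nat (t + 1) * ((1 - \<beta> ^ n) * g) + (1 - \<beta> ^ nat (t + 1)) * (k * g)) /
            (1 - \<beta> ^ (n + nat (t + 1))))"
  proof
    fix n
    \<comment> \<open>The gradients processed are \<open>n\<close> before timestep \<open>0\<close>
      and \<open>t + 1\<close> from there on. In this form the correction is a shifted power
      sequence.\<close>
    have "nat (t - - int n + 1) = n + nat (t + 1)"
      using assms(3) by simp
    then show "adam_m_hat \<beta> (step_gradient g k) (- int n) t =
        (\<beta> ^ nat (t + 1) * ((1 - \<beta> ^ n) * g) + (1 - \<beta> ^ nat (t + 1)) * (k * g)) /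
          (1 - \<beta> ^ (n + nat (t + 1)))"
      unfolding adam_m_hat_def adam_m_step_gradient[OF assms(3)] by (rule arg_cong)
  qed
  also have "\<dots> \<longlonglongrightarrow>
      (\<beta> ^ nat (t + 1) * ((1 - 0) * g) + (1 - \<beta> ^ nat (t + 1)) * (k * g)) / (1 - 0)"
    by (intro tendsto_divide tendsto_add tendsto_mult tendsto_diff tendsto_const pow
        LIMSEQ_ignore_initial_segment) simp
  finally show ?thesis
    by (simp add: algebra_simps)
qed

lemma adam_v_eq_adam_m: "adam_v \<beta> G s0 s = adam_m \<beta> (\<lambda>r. (G r)\<^sup>2) s0 s"
proof (induction \<beta> G s0 s rule: adam_v.induct)
  case (1 \<beta> G s0 s)
  then show ?case
    by (subst adam_v.simps, subst adam_m.simps) simp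
qed

text \<open>The values \<open>g\<close> and \<open>k * g\<close> square to \<open>g\<^sup>2\<close>
  and \<open>k\<^sup>2 * g\<^sup>2\<close>, so the limit found for the first moment also serves the
  second.\<close>

lemma adam_v_hat_step_gradient:
  "adam_v_hat \<beta> (step_gradient g k) s0 t = adam_m_hat \<beta> (step_gradient (g\<^sup>2) (k\<^sup>2)) s0 t"
proof -
  have "(\<lambda>r. (step_gradient g k r)\<^sup>2) = step_gradient (g\<^sup>2) (k\<^sup>2)"
    by (auto simp: step_gradient_def power_mult_distrib)
  then show ?thesis
    by (simp add: adam_v_hat_def adam_m_hat_def adam_v_eq_adam_m)
qed

theorem theorem3p1:
  fixes \<beta>1 \<beta>2 g k :: real and t :: int
  assumes "0 \<le> \<beta>1" and "\<beta>1 < 1"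
    and "0 \<le> \<beta>2" and "\<beta>2 < 1"
    and "0 < g" and "0 < k"
    and "0 \<le> t"
  defines "L \<equiv> (\<beta>1 ^ nat (t + 1) + k * (1 - \<beta>1 ^ nat (t + 1))) /
                sqrt (\<beta>2 ^ nat (t + 1) + k\<^sup>2 * (1 - \<beta>2 ^ nat (t + 1)))"
  shows "((\<lambda>t'::nat. adam_update \<beta>1 \<beta>2 0 (step_gradient g k) (- int t') t) \<longlonglongrightarrow> L) \<and>
         ((\<lambda>t'::nat. adam_m_hat \<beta>1 (step_gradient g k) (- int t') t /
                     sqrt (adam_v_hat \<beta>2 (step_gradient g k) (- int t') t)) \<longlonglongrightarrow> L)"
proof -
  let ?a = "\<beta>1 ^ nat (t + 1) + k * (1 - \<beta>1 ^ nat (t + 1))"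
  let ?b = "\<beta>2 ^ nat (t + 1) + k\<^sup>2 * (1 - \<beta>2 ^ nat (t + 1))"
  \<comment> \<open>Since the exponent is at least \<open>1\<close>, the weight of
    \<open>k\<^sup>2\<close> is strictly positive, which keeps the limiting denominator nonzero even
    for \<open>\<beta>2 = 0\<close>.\<close>
  have "\<beta>2 ^ nat (t + 1) < 1"
    using assms by (simp add: power_less_one_iff)
  then have b_pos: "0 < ?b"
    using assms by (intro add_nonneg_pos mult_pos_pos) auto
  have "(\<lambda>n. adam_m_hat \<beta>1 (step_gradient g k) (- int n) t /
          sqrt (adam_v_hat \<beta>2 (step_gradient g k) (- int n) t))
      \<longlonglongrightarrow> (g * ?a) / sqrt (g\<^sup>2 * ?b)"
    unfolding adam_v_hat_step_gradient
    using assms b_pos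
    by (intro tendsto_divide tendsto_real_sqrt adam_m_hat_step_gradient_tendsto) auto
  \<comment> \<open>As \<open>g\<close> is positive, \<open>sqrt (g\<^sup>2) = g\<close>, and the
    gradient scale cancels.\<close>
  also have "(g * ?a) / sqrt (g\<^sup>2 * ?b) = L"
    using \<open>0 < g\<close> by (simp add: L_def real_sqrt_mult)
  finally show ?thesis
    by (simp add: adam_update_def)
qed

end
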